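(* Let $V$ be a vertex operator algebra with an integral form $V_{\mathbb{Z}}$, and let $W^{(1)}$, $W^{(2)}$, $W^{(3)}$ be $V$-modules with integral forms $W^{(1)}_{\mathbb{Z}}$, $W^{(2)}_{\mathbb{Z}}$, $W^{(3)}_{\mathbb{Z}}$, respectively. Let $T^{(1)}$ and $T^{(2)}$ be generating sets for $W^{(1)}_{\mathbb{Z}}$ and $W^{(2)}_{\mathbb{Z}}$, respectively. If $\mathcal{Y}$ is an intertwining operator of type $\binom{W^{(3)}}{W^{(1)}\,W^{(2)}}$ such that $$\mathcal{Y}(t_{(1)},x)t_{(2)}\in W^{(3)}_{\mathbb{Z}}\{x\}$$ for all $t_{(1)}\in T^{(1)}$ and $t_{(2)}\in T^{(2)}$, then $\mathcal{Y}$ is integral with respect to $W^{(1)}_{\mathbb{Z}}$, $W^{(2)}_{\mathbb{Z}}$ and $W^{(3)}_{\mathbb{Z}}$.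
   Context: Everything is over $\mathbb{C}$. Vertex operator algebras are in the sense of Frenkel–Lepowsky–Meurman; modules for a vertex operator algebra have a conformal weight ($L(0)$-eigenvalue) grading by $\mathbb{C}$ with the usual grading-restriction conditions. For $v\in V$ and a module $W$, write $Y_W(v,x)=\sum_{n\in\mathbb{Z}}v_n x^{-n-1}$. An integral form of a complex vector space is the $\mathbb{Z}$-span of a basis. An integral form $V_{\mathbb{Z}}$ of $V$ is an integral form of the vector space $V$ that contains the vacuum $\mathbf{1}$, is closed under all products $u_nv$ ($n\in\mathbb{Z}$), and is compatible with the weight grading: $V_{\mathbb{Z}}=\coprod_{n\in\mathbb{Z}}V_n\cap V_{\mathbb{Z}}$, where $V_n$ is the $L(0)$-eigenspace of eigenvalue $n$. Given $V_{\mathbb{Z}}$, an integral form $W_{\mathbb{Z}}$ of a $V$-module $W$ is an integral form of the vector space $W$ that is preserved by all $v_n$ with $v\in V_{\mathbb{Z}}$, $n\in\mathbb{Z}$ (i.e. is a $V_{\mathbb{Z}}$-submodule) and satisfies $W_{\mathbb{Z}}=\coprod_{h\in\mathbb{C}}W_h\cap W_{\mathbb{Z}}$. A subset $T\subseteq W_{\mathbb{Z}}$ generates $W_{\mathbb{Z}}$ if $W_{\mathbb{Z}}$ is the smallest $V_{\mathbb{Z}}$-submodule of $W$ containing $T$. For an abelian group $M$, $M\{x\}$ is the space of formal series in arbitrary complex powers of $x$ with coefficients in $M$. An intertwining operator of type $\binom{W^{(3)}}{W^{(1)}\,W^{(2)}}$ is a linear map $\mathcal{Y}:W^{(1)}\otimes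 W^{(2)}\to W^{(3)}\{x\}$, $w_{(1)}\otimes w_{(2)}\mapsto \mathcal{Y}(w_{(1)},x)w_{(2)}=\sum_{n\in\mathbb{C}}(w_{(1)})_nw_{(2)}x^{-n-1}$, satisfying: (1) lower truncation: for all $w_{(1)},w_{(2)}$ and $n\in\mathbb{C}$, $(w_{(1)})_{n+m}w_{(2)}=0$ for $m\in\mathbb{N}$ sufficiently large; (2) the Jacobi identity $$x_0^{-1}\delta\left(\tfrac{x_1-x_2}{x_0}\right)Y_{W^{(3)}}(v,x_1)\mathcal{Y}(w_{(1)},x_2)-x_0^{-1}\delta\left(\tfrac{x_2-x_1}{-x_0}\right)\mathcal{Y}(w_{(1)},x_2)Y_{W^{(2)}}(v,x_1)=x_2^{-1}\delta\left(\tfrac{x_1-x_0}{x_2}\right)\mathcal{Y}(Y_{W^{(1)}}(v,x_0)w_{(1)},x_2)$$ for $v\in V$, $w_{(1)}\in W^{(1)}$; (3) $\mathcal{Y}(L(-1)w_{(1)},x)=\frac{d}{dx}\mathcal{Y}(w_{(1)},x)$. $\mathcal{Y}$ is integral with respect to $W^{(1)}_{\mathbb{Z}},W^{(2)}_{\mathbb{Z}},W^{(3)}_{\mathbb{Z}}$ if $\mathcal{Y}(w_{(1)},x)w_{(2)}\in W^{(3)}_{\mathbb{Z}}\{x\}$ for all $w_{(1)}\in W^{(1)}_{\mathbb{Z}}$, $w_{(2)}\in W^{(2)}_{\mathbb{Z}}$. *)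

theory Defs
  imports Complex_Main "HOL-Library.Groups_Big_Fun"
begin

text \<open>
  Complex vector spaces are given by a scalar multiplication in the sense of the locale
  \<^locale>\<open>vector_space\<close>, the carrier being the whole type. A vertex operator
  \<open>Y(w, x) u = \<Sum>n. w\<^sub>n u x\<^bsup>-n-1\<^esup>\<close> is represented by its modes: \<open>Y w n u\<close> is the
  coefficient of \<open>x\<^bsup>-n-1\<^esup>\<close>. The index \<open>n\<close> is an integer for algebras and modules and a complex
  number for intertwining operators.
\<close>

definition int_scale :: "(complex \<Rightarrow> 'a \<Rightarrow> 'a) \<Rightarrow> int \<Rightarrow> 'a \<Rightarrow> 'a" where
  "int_scale s n w = s (of_int n) w"

definition is_direct_sum :: "'a::ab_group_add set \<Rightarrow> ('i \<Rightarrow> 'a set) \<Rightarrow> bool" where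
  "is_direct_sum S A \<longleftrightarrow>
     bij_betw Sum_any {f. finite {i. f i \<noteq> 0} \<and> (\<forall>i. f i \<in> A i)} S"

definition bilinear_modes ::
  "(complex \<Rightarrow> 'a::ab_group_add \<Rightarrow> 'a) \<Rightarrow> (complex \<Rightarrow> 'b::ab_group_add \<Rightarrow> 'b) \<Rightarrow>
   (complex \<Rightarrow> 'c::ab_group_add \<Rightarrow> 'c) \<Rightarrow> ('a \<Rightarrow> 'e \<Rightarrow> 'b \<Rightarrow> 'c) \<Rightarrow> bool" where
  "bilinear_modes s1 s2 s3 Y \<longleftrightarrow>
     (\<forall>a n. Vector_Spaces.linear s2 s3 (\<lambda>b. Y a n b)) \<and>
     (\<forall>b n. Vector_Spaces.linear s1 s3 (\<lambda>a. Y a n b))"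


section \<open>The Jacobi identity\<close>

text \<open>
  The coefficient of \<open>t\<^sup>k y\<^sup>a z\<^sup>b\<close> in \<open>t\<^bsup>-1\<^esup> \<delta>((y - z)/t) = \<Sum>n\<in>\<int>. t\<^bsup>-n-1\<^esup> (y - z)\<^sup>n\<close>, where
  \<open>(y - z)\<^sup>n\<close> is expanded in nonnegative powers of \<open>z\<close>.
\<close>

definition delta_coeff :: "int \<Rightarrow> int \<Rightarrow> int \<Rightarrow> complex" where
  "delta_coeff k a b =
     (if b \<ge> 0 \<and> k + a + b = -1 then (-1) ^ nat b * (of_int (-k - 1) gchoose nat b) else 0)"

text \<open>
  Formal series in \<open>x\<^sub>0, x\<^sub>1, x\<^sub>2\<close> are functions of the three exponents. Below we multiply
  scalar series by vector-valued ones; \<^const>\<open>Sum_any\<close> is \<open>0\<close> if infinitely many terms are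
  nonzero, but in each of the three products of the Jacobi identity lower truncation makes
  the sums finite.
\<close>

definition series_mult ::
  "(complex \<Rightarrow> 'w \<Rightarrow> 'w) \<Rightarrow> (int \<Rightarrow> int \<Rightarrow> int \<Rightarrow> complex) \<Rightarrow> (int \<Rightarrow> int \<Rightarrow> 'e \<Rightarrow> 'w) \<Rightarrow>
   int \<Rightarrow> int \<Rightarrow> 'e::ring_1 \<Rightarrow> 'w::ab_group_add" where
  "series_mult s D F k m n =
     Sum_any (\<lambda>(p, q, r). s (D p q r) (F (k - p) (m - q) (n - of_int r)))"

text \<open>
  The three scalar series are \<open>x\<^sub>0\<^bsup>-1\<^esup> \<delta>((x\<^sub>1 - x\<^sub>2)/x\<^sub>0)\<close>,
  \<open>x\<^sub>0\<^bsup>-1\<^esup> \<delta>((x\<^sub>2 - x\<^sub>1)/(-x\<^sub>0)) = -(-x\<^sub>0)\<^bsup>-1\<^esup> \<delta>((x\<^sub>2 - x\<^sub>1)/(-x\<^sub>0))\<close> and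
  \<open>x\<^sub>2\<^bsup>-1\<^esup> \<delta>((x\<^sub>1 - x\<^sub>0)/x\<^sub>2)\<close>. The vector-valued series are
  \<open>Y\<^sub>3(v, x\<^sub>1) I(w\<^sub>1, x\<^sub>2) w\<^sub>2\<close>, \<open>I(w\<^sub>1, x\<^sub>2) Y\<^sub>2(v, x\<^sub>1) w\<^sub>2\<close> and
  \<open>I(Y\<^sub>1(v, x\<^sub>0) w\<^sub>1, x\<^sub>2) w\<^sub>2\<close>.
\<close>

definition jacobi_identity ::
  "(complex \<Rightarrow> 'w3 \<Rightarrow> 'w3) \<Rightarrow> ('v \<Rightarrow> int \<Rightarrow> 'w1 \<Rightarrow> 'w1) \<Rightarrow> ('v \<Rightarrow> int \<Rightarrow> 'w2 \<Rightarrow> 'w2) \<Rightarrow>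
   ('v \<Rightarrow> int \<Rightarrow> 'w3 \<Rightarrow> 'w3) \<Rightarrow> ('w1 \<Rightarrow> 'e::ring_1 \<Rightarrow> 'w2 \<Rightarrow> 'w3::ab_group_add) \<Rightarrow> bool" where
  "jacobi_identity s Y1 Y2 Y3 I \<longleftrightarrow>
     (\<forall>v w1 w2 k m n.
        series_mult s (\<lambda>p q r. delta_coeff p q r)
          (\<lambda>p q r. if p = 0 then Y3 v (-q - 1) (I w1 (-r - 1) w2) else 0) k m n
        - series_mult s (\<lambda>p q r. - ((-1) powi p) * delta_coeff p r q)
            (\<lambda>p q r. if p = 0 then I w1 (-r - 1) (Y2 v (-q - 1) w2) else 0) k m n
        = series_mult s (\<lambda>p q r. delta_coeff r q p)
            (\<lambda>p q r. if q = 0 then I (Y1 v (-p - 1) w1) (-r - 1) w2 else 0) k m n)"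


section \<open>Vertex operator algebras, modules, intertwining operators\<close>

text \<open>\<open>L(n) = \<omega>\<^bsub>n+1\<^esub>\<close>, where \<open>Y(\<omega>, x) = \<Sum>n. L(n) x\<^bsup>-n-2\<^esup>\<close>.\<close>

definition vir :: "('v \<Rightarrow> int \<Rightarrow> 'w \<Rightarrow> 'w) \<Rightarrow> 'v \<Rightarrow> int \<Rightarrow> 'w \<Rightarrow> 'w" where
  "vir Y \<omega> n w = Y \<omega> (n + 1) w"

definition virasoro_relations ::
  "(complex \<Rightarrow> 'w::ab_group_add \<Rightarrow> 'w) \<Rightarrow> ('v \<Rightarrow> int \<Rightarrow> 'w \<Rightarrow> 'w) \<Rightarrow> 'v \<Rightarrow> complex \<Rightarrow> bool" where
  "virasoro_relations s Y \<omega> c \<longleftrightarrow>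
     (\<forall>m n w. vir Y \<omega> m (vir Y \<omega> n w) - vir Y \<omega> n (vir Y \<omega> m w)
        = s (of_int (m - n)) (vir Y \<omega> (m + n) w)
          + (if m + n = 0 then s (of_int (m ^ 3 - m) / 12 * c) w else 0))"

definition weight_space ::
  "(complex \<Rightarrow> 'w \<Rightarrow> 'w) \<Rightarrow> ('v \<Rightarrow> int \<Rightarrow> 'w \<Rightarrow> 'w) \<Rightarrow> 'v \<Rightarrow> complex \<Rightarrow> 'w set" where
  "weight_space s Y \<omega> h = {w. vir Y \<omega> 0 w = s h w}"

text \<open>
  In the derivative properties below, the coefficient of \<open>x\<^bsup>-n-1\<^esup>\<close> in
  \<open>d/dx \<Sum>m. a\<^sub>m x\<^bsup>-m-1\<^esup>\<close> is \<open>-n a\<^bsub>n-1\<^esub>\<close>.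
\<close>

locale vertex_operator_algebra = vector_space sV
  for sV :: "complex \<Rightarrow> 'v::ab_group_add \<Rightarrow> 'v" +
  fixes Y :: "'v \<Rightarrow> int \<Rightarrow> 'v \<Rightarrow> 'v"
    and vac :: 'v and \<omega> :: 'v and c :: complex
  assumes bilinear: "bilinear_modes sV sV sV Y"
    and grading: "is_direct_sum UNIV (\<lambda>n::int. weight_space sV Y \<omega> (of_int n))"
    and finite_dim: "\<And>n::int. \<exists>B. finite B \<and> weight_space sV Y \<omega> (of_int n) \<subseteq> span B"
    and weights_bounded_below:
      "\<exists>N::int. \<forall>n<N. weight_space sV Y \<omega> (of_int n) = {0}"
    and truncation: "\<And>u v. \<exists>N. \<forall>n\<ge>N. Y u n v = 0"
    and vacuum: "\<And>n v. Y vac n v = (if n = -1 then v else 0)"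
    and creation: "\<And>n v. n \<ge> 0 \<Longrightarrow> Y v n vac = 0" "\<And>v. Y v (-1) vac = v"
    and jacobi: "jacobi_identity sV Y Y Y Y"
    and virasoro: "virasoro_relations sV Y \<omega> c"
    and derivative: "\<And>u n v. Y (vir Y \<omega> (-1) u) n v = sV (- of_int n) (Y u (n - 1) v)"

locale voa_module = V: vertex_operator_algebra sV Y vac \<omega> c + W: vector_space sW
  for sV :: "complex \<Rightarrow> 'v::ab_group_add \<Rightarrow> 'v"
    and Y :: "'v \<Rightarrow> int \<Rightarrow> 'v \<Rightarrow> 'v"
    and vac :: 'v and \<omega> :: 'v and c :: complex
    and sW :: "complex \<Rightarrow> 'w::ab_group_add \<Rightarrow> 'w" +
  fixes YW :: "'v \<Rightarrow> int \<Rightarrow> 'w \<Rightarrow> 'w"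
  assumes bilinear: "bilinear_modes sV sW sW YW"
    and grading: "is_direct_sum UNIV (\<lambda>h::complex. weight_space sW YW \<omega> h)"
    and finite_dim: "\<And>h. \<exists>B. finite B \<and> weight_space sW YW \<omega> h \<subseteq> W.span B"
    and weights_bounded_below:
      "\<And>h. \<exists>N::int. \<forall>n<N. weight_space sW YW \<omega> (h + of_int n) = {0}"
    and truncation: "\<And>v w. \<exists>N. \<forall>n\<ge>N. YW v n w = 0"
    and vacuum: "\<And>n w. YW vac n w = (if n = -1 then w else 0)"
    and jacobi: "jacobi_identity sW Y YW YW YW"
    and virasoro: "virasoro_relations sW YW \<omega> c"
    and derivative: "\<And>v n w. YW (vir Y \<omega> (-1) v) n w = sW (- of_int n) (YW v (n - 1) w)"

text \<open>An intertwining operator \<open>I\<close> of type \<open>W3\<close> over \<open>W1 W2\<close>.\<close>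

locale intertwining_operator =
  W1: voa_module sV Y vac \<omega> c sW1 YW1 +
  W2: voa_module sV Y vac \<omega> c sW2 YW2 +
  W3: voa_module sV Y vac \<omega> c sW3 YW3
  for sV :: "complex \<Rightarrow> 'v::ab_group_add \<Rightarrow> 'v"
    and Y :: "'v \<Rightarrow> int \<Rightarrow> 'v \<Rightarrow> 'v"
    and vac :: 'v and \<omega> :: 'v and c :: complex
    and sW1 :: "complex \<Rightarrow> 'w1::ab_group_add \<Rightarrow> 'w1" and YW1 :: "'v \<Rightarrow> int \<Rightarrow> 'w1 \<Rightarrow> 'w1"
    and sW2 :: "complex \<Rightarrow> 'w2::ab_group_add \<Rightarrow> 'w2" and YW2 :: "'v \<Rightarrow> int \<Rightarrow> 'w2 \<Rightarrow> 'w2"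
    and sW3 :: "complex \<Rightarrow> 'w3::ab_group_add \<Rightarrow> 'w3" and YW3 :: "'v \<Rightarrow> int \<Rightarrow> 'w3 \<Rightarrow> 'w3" +
  fixes I :: "'w1 \<Rightarrow> complex \<Rightarrow> 'w2 \<Rightarrow> 'w3"
  assumes bilinear: "bilinear_modes sW1 sW2 sW3 I"
    and truncation: "\<And>w1 w2 n. \<exists>M::nat. \<forall>m\<ge>M. I w1 (n + of_nat m) w2 = 0"
    and jacobi: "jacobi_identity sW3 YW1 YW2 YW3 I"
    and derivative: "\<And>w1 n w2. I (vir YW1 \<omega> (-1) w1) n w2 = sW3 (- n) (I w1 (n - 1) w2)"


section \<open>Integral forms\<close>

definition vs_integral_form :: "(complex \<Rightarrow> 'a::ab_group_add \<Rightarrow> 'a) \<Rightarrow> 'a set \<Rightarrow> bool" where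
  "vs_integral_form s L \<longleftrightarrow>
     (\<exists>B. \<not> module.dependent s B \<and> module.span s B = UNIV \<and> L = module.span (int_scale s) B)"

definition voa_integral_form ::
  "(complex \<Rightarrow> 'v::ab_group_add \<Rightarrow> 'v) \<Rightarrow> ('v \<Rightarrow> int \<Rightarrow> 'v \<Rightarrow> 'v) \<Rightarrow> 'v \<Rightarrow> 'v \<Rightarrow> 'v set \<Rightarrow> bool" where
  "voa_integral_form sV Y vac \<omega> VZ \<longleftrightarrow>
     vs_integral_form sV VZ \<and> vac \<in> VZ \<and>
     (\<forall>u\<in>VZ. \<forall>v\<in>VZ. \<forall>n. Y u n v \<in> VZ) \<and>
     is_direct_sum VZ (\<lambda>n::int. weight_space sV Y \<omega> (of_int n) \<inter> VZ)"

definition integral_submodule ::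
  "'v set \<Rightarrow> (complex \<Rightarrow> 'w::ab_group_add \<Rightarrow> 'w) \<Rightarrow> ('v \<Rightarrow> int \<Rightarrow> 'w \<Rightarrow> 'w) \<Rightarrow> 'w set \<Rightarrow> bool" where
  "integral_submodule VZ sW YW M \<longleftrightarrow>
     module.subspace (int_scale sW) M \<and> (\<forall>v\<in>VZ. \<forall>n. \<forall>w\<in>M. YW v n w \<in> M)"

definition module_integral_form ::
  "'v set \<Rightarrow> 'v \<Rightarrow> (complex \<Rightarrow> 'w::ab_group_add \<Rightarrow> 'w) \<Rightarrow> ('v \<Rightarrow> int \<Rightarrow> 'w \<Rightarrow> 'w) \<Rightarrow> 'w set \<Rightarrow> bool"
where
  "module_integral_form VZ \<omega> sW YW WZ \<longleftrightarrow>
     vs_integral_form sW WZ \<and> integral_submodule VZ sW YW WZ \<and>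
     is_direct_sum WZ (\<lambda>h::complex. weight_space sW YW \<omega> h \<inter> WZ)"

definition generates ::
  "'v set \<Rightarrow> (complex \<Rightarrow> 'w::ab_group_add \<Rightarrow> 'w) \<Rightarrow> ('v \<Rightarrow> int \<Rightarrow> 'w \<Rightarrow> 'w) \<Rightarrow> 'w set \<Rightarrow> 'w set \<Rightarrow> bool"
where
  "generates VZ sW YW T WZ \<longleftrightarrow>
     T \<subseteq> WZ \<and> integral_submodule VZ sW YW WZ \<and>
     (\<forall>M. integral_submodule VZ sW YW M \<and> T \<subseteq> M \<longrightarrow> WZ \<subseteq> M)"

text \<open>\<open>M{x}\<close>, a series being given by its modes as for vertex operators.\<close>

definition formal_series :: "'a set \<Rightarrow> (complex \<Rightarrow> 'a) set" where
  "formal_series M = {f. \<forall>n. f n \<in> M}"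

definition integral_intertwining ::
  "('w1 \<Rightarrow> complex \<Rightarrow> 'w2 \<Rightarrow> 'w3) \<Rightarrow> 'w1 set \<Rightarrow> 'w2 set \<Rightarrow> 'w3 set \<Rightarrow> bool" where
  "integral_intertwining I W1Z W2Z W3Z \<longleftrightarrow>
     (\<forall>w1\<in>W1Z. \<forall>w2\<in>W2Z. (\<lambda>n. I w1 n w2) \<in> formal_series W3Z)"

end

theory Submission
  imports Defs
begin

text \<open>
  Taking a power of \<open>x\<^sub>0\<close> in the Jacobi identity that kills the right-hand side (weak commutativity)
  expresses \<open>I(w\<^sub>1, x) v\<^sub>j w\<^sub>2\<close> through \<open>v\<^sub>i I(w\<^sub>1, x) w\<^sub>2\<close> and \<open>I(w\<^sub>1, x) v\<^sub>i w\<^sub>2\<close> with \<open>i > j\<close>, with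
  integer coefficients. Descending induction on \<open>j\<close> thus extends integrality from the generators of
  the second module to the whole of it while \<open>w\<^sub>1\<close> stays fixed; the ordinary commutator formula
  would involve \<open>v\<^sub>i w\<^sub>1\<close>, about which nothing is known yet. The iterate formula then extends
  integrality in \<open>w\<^sub>1\<close>.
\<close>

section \<open>Coefficients of the delta series\<close>

lemma minus_one_power_int_in_Ints: "(-1 :: 'a :: field_char_0) powi p \<in> \<int>"
  by (simp add: power_int_minus_left)

text \<open>Cuts the expansion of \<open>(y - z)^a\<close> off after finitely many terms when
  \<open>a\<close> is nonnegative.\<close>

lemma gbinomial_of_int_eq_0:
  assumes "0 \<le> a" and "a < int b"
  shows "(of_int a :: 'a :: field_char_0) gchoose b = 0"
proof -
  have "(of_int a :: 'a) gchoose b = of_nat (nat a choose b)"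
    using assms by (simp add: binomial_gbinomial)
  with assms show ?thesis
    by (simp add: binomial_eq_0)
qed

text \<open>Even for a negative integer upper index, the generalized binomial coefficient can be
  computed in \<open>int\<close>.\<close>

lemma delta_coeff_in_Ints: "delta_coeff k a b \<in> \<int>"
proof -
  have "(of_int (- k - 1) :: complex) gchoose nat b \<in> \<int>"
    unfolding of_int_gbinomial [symmetric] by (rule Ints_of_int)
  then show ?thesis
    unfolding delta_coeff_def by (simp del: of_int_diff of_int_minus)
qed

lemma module_int_scale:
  assumes "vector_space s"
  shows "module (int_scale s)"
proof -
  interpret vector_space s by fact
  show ?thesis
    by unfold_locales (simp_all add: int_scale_def algebra_simps)
qed

section \<open>Subgroups of a complex vector space\<close>

context
  fixes s :: "complex \<Rightarrow> 'a::ab_group_add \<Rightarrow> 'a" and L :: "'a set"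
  assumes vs: "vector_space s" and L: "module.subspace (int_scale s) L"
begin

interpretation Z: module "int_scale s"
  using vs by (rule module_int_scale)

lemma int_subspace_scale:
  assumes "z \<in> \<int>" and "x \<in> L"
  shows "s z x \<in> L"
  using assms Z.subspace_scale [OF L, of x] by (auto simp: Ints_def int_scale_def)

text \<open>If the support is infinite, the sum is 0 by convention, and 0 lies in
  \<open>L\<close>.\<close>

lemma int_subspace_Sum_any:
  assumes "\<And>i. f i \<in> L"
  shows "Sum_any f \<in> L"
  unfolding Sum_any.expand_set using assms by (intro Z.subspace_sum [OF L])

lemma int_subspace_series_mult:
  assumes "\<And>p q r. D p q r \<in> \<int>" and "\<And>p q r. F p q r \<in> L"
  shows "series_mult s D F k m n \<in> L"
  unfolding series_mult_def
  by (rule int_subspace_Sum_any) (auto intro: int_subspace_scale assms)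

text \<open>Solves the sum for its \<open>j\<close>-th term. Finite support matters: otherwise the
  sum is 0 by convention and carries no information.\<close>

lemma int_subspace_isolate:
  assumes "Sum_any f \<in> L" and fin: "finite {i. f i \<noteq> 0}" and rest: "\<And>i. i \<noteq> j \<Longrightarrow> f i \<in> L"
  shows "f j \<in> L"
proof -
  let ?S = "insert j {i. f i \<noteq> 0}"
  have "Sum_any f = sum f ?S"
    using fin by (intro Sum_any.expand_superset) auto
  also have "\<dots> = f j + sum f (?S - {j})"
    using fin by (intro sum.remove) auto
  finally have "f j = Sum_any f - sum f (?S - {j})"
    by simp
  also have "\<dots> \<in> L"
    using assms(1) by (intro Z.subspace_diff [OF L] Z.subspace_sum [OF L] rest) auto
  finally show ?thesis .
qed

text \<open>An intersection of preimages of \<open>L\<close> under linear maps. With modes of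
  \<open>I\<close> as the maps, such sets are compared with a generated module by
  minimality.\<close>

lemma int_subspace_linear_vimage:
  assumes lin: "\<And>i. i \<in> A \<Longrightarrow> Vector_Spaces.linear s' s (f i)" and vs': "vector_space s'"
  shows "module.subspace (int_scale s') {w. \<forall>i\<in>A. f i w \<in> L}"
proof -
  interpret Z': module "int_scale s'"
    using vs' by (rule module_int_scale)
  have hom: "f i 0 = 0" "f i (x + y) = f i x + f i y" "f i (s' z x) = s z (f i x)" if "i \<in> A" for i x y z
  proof -
    interpret Vector_Spaces.linear s' s "f i"
      using that by (rule lin)
    show "f i 0 = 0" "f i (x + y) = f i x + f i y" "f i (s' z x) = s z (f i x)"
      by (rule zero add scale)+
  qed
  show ?thesis
    by (rule Z'.subspaceI)
      (auto simp: hom int_scale_def intro: Z.subspace_0 [OF L] Z.subspace_add [OF L] int_subspace_scale)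
qed

end

section \<open>Integrality under the action of modes\<close>

context intertwining_operator
begin

lemma linear_right: "Vector_Spaces.linear sW2 sW3 (\<lambda>w2. I w1 n w2)"
  and linear_left: "Vector_Spaces.linear sW1 sW3 (\<lambda>w1. I w1 n w2)"
  using bilinear by (auto simp: bilinear_modes_def)

lemma mode_zero [simp]: "I 0 n w2 = 0" "I w1 n 0 = 0"
proof -
  interpret l: Vector_Spaces.linear sW1 sW3 "\<lambda>w1. I w1 n w2" by (rule linear_left)
  interpret r: Vector_Spaces.linear sW2 sW3 "\<lambda>w2. I w1 n w2" by (rule linear_right)
  show "I 0 n w2 = 0" "I w1 n 0 = 0" by (rule l.zero r.zero)+
qed

context
  fixes VZ and L
  assumes L: "integral_submodule VZ sW3 YW3 L"
begin

lemma L_subspace: "module.subspace (int_scale sW3) L"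
  and L_closed: "v \<in> VZ \<Longrightarrow> w \<in> L \<Longrightarrow> YW3 v i w \<in> L"
  using L by (auto simp: integral_submodule_def)

interpretation Z3: module "int_scale sW3"
  using W3.W.vector_space_axioms by (rule module_int_scale)

lemma integral_first_series:
  assumes "v \<in> VZ" and "\<And>n. I w1 n w2 \<in> L"
  shows "series_mult sW3 (\<lambda>p q r. delta_coeff p q r)
    (\<lambda>p q r. if p = 0 then YW3 v (- q - 1) (I w1 (- r - 1) w2) else 0) k m n \<in> L"
  using W3.W.vector_space_axioms L_subspace
  by (rule int_subspace_series_mult)
    (auto intro: delta_coeff_in_Ints L_closed assms Z3.subspace_0 [OF L_subspace])

lemma weak_commutativity_integral:
  assumes v: "v \<in> VZ" and w2: "\<And>n. I w1 n w2 \<in> L" and IH: "\<And>i n. i > j \<Longrightarrow> I w1 n (YW2 v i w2) \<in> L"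
  shows "I w1 n (YW2 v j w2) \<in> L"
proof -
  obtain N0 where N0: "\<And>i. i \<ge> N0 \<Longrightarrow> YW1 v i w1 = 0"
    using W1.truncation by blast
  \<comment> \<open>A natural number, so that \<open>(x_1 - x_2)^N\<close> is a polynomial.\<close>
  define N where "N = nat N0"
  have N: "YW1 v i w1 = 0" if "i \<ge> int N" for i
    using that by (intro N0) (simp add: N_def split: if_splits)
  \<comment> \<open>The power \<open>x_0^k\<close> selects \<open>(x_1 - x_2)^N\<close>. The
    exponents \<open>m\<close> of \<open>x_1\<close> and \<open>n'\<close> of \<open>x_2\<close> are
    chosen so that the term \<open>q = 0\<close>, \<open>r = N\<close> contains the wanted
    \<open>I w1 n (YW2 v j w2)\<close>, while \<open>q > 0\<close> gives the modes
    \<open>j + q\<close>, covered by \<open>IH\<close>.\<close>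
  define k m :: int where "k = - int N - 1" and "m = - j - 1"
  define n' :: complex where "n' = of_nat N - 1 - n"
  let ?f = "\<lambda>(p, q, r). sW3 (- ((-1) powi p) * delta_coeff p r q)
    (if k - p = 0 then I w1 (- (n' - of_int r) - 1) (YW2 v (- (m - q) - 1) w2) else 0)"
  \<comment> \<open>For \<open>p \<ge> 0\<close> the mode \<open>N + p\<close> of \<open>v\<close>
    kills \<open>w1\<close>; for \<open>p < 0\<close> the delta coefficient vanishes.\<close>
  have "sW3 (delta_coeff r q p) (if m - q = 0 then I (YW1 v (- (k - p) - 1) w1) a w2 else 0) = 0" for p q r a
    by (cases "p \<ge> 0") (auto simp: k_def N delta_coeff_def)
  then have "series_mult sW3 (\<lambda>p q r. delta_coeff r q p)
      (\<lambda>p q r. if q = 0 then I (YW1 v (- p - 1) w1) (- r - 1) w2 else 0) k m n' = 0"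
    by (simp only: series_mult_def Sum_any.neutral case_prod_unfold)
  moreover have "series_mult sW3 (\<lambda>p q r. delta_coeff p q r)
      (\<lambda>p q r. if p = 0 then YW3 v (- q - 1) (I w1 (- r - 1) w2) else 0) k m n' - Sum_any ?f
    = series_mult sW3 (\<lambda>p q r. delta_coeff r q p)
      (\<lambda>p q r. if q = 0 then I (YW1 v (- p - 1) w1) (- r - 1) w2 else 0) k m n'"
    using jacobi unfolding jacobi_identity_def series_mult_def by blast
  ultimately have sum: "Sum_any ?f \<in> L"
    using integral_first_series [OF v w2, of k m n'] by (simp only: right_minus_eq)
  have supp: "p = k \<and> q \<ge> 0 \<and> q \<le> int N \<and> r = int N - q" if nz: "?f (p, q, r) \<noteq> 0" for p q r
  proof -
    have "p = k" and d: "delta_coeff p r q \<noteq> 0"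
      using nz by (auto split: if_splits)
    then have q: "q \<ge> 0" "r = int N - q" and "(of_int (int N) :: complex) gchoose nat q \<noteq> 0"
      by (auto simp: delta_coeff_def k_def split: if_splits)
    then have "\<not> int N < int (nat q)"
      using gbinomial_of_int_eq_0 [of "int N" "nat q"] by auto
    with q \<open>p = k\<close> show ?thesis by auto
  qed
  have "{x. ?f x \<noteq> 0} \<subseteq> (\<lambda>q. (k, q, int N - q)) ` {0..int N}"
    using supp by (force simp del: split_conv)
  then have fin: "finite {x. ?f x \<noteq> 0}"
    by (rule finite_subset) simp
  have "?f x \<in> L" if "x \<noteq> (k, 0, int N)" for x
  proof (cases "?f x = 0")
    case True
    then show ?thesis using Z3.subspace_0 [OF L_subspace] by simp
  next
    case False
    obtain p q r where x: "x = (p, q, r)" by (cases x)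
    have "p = k" "q > 0"
      using supp [of p q r] False that by (auto simp: x)
    moreover have "- ((-1) powi p) * delta_coeff p r q \<in> \<int>"
      by (intro Ints_mult Ints_minus minus_one_power_int_in_Ints delta_coeff_in_Ints)
    ultimately show ?thesis
      by (auto simp: x m_def simp del: W3.W.scale_minus_left
          intro!: IH int_subspace_scale [OF W3.W.vector_space_axioms L_subspace])
  qed
  from int_subspace_isolate [OF W3.W.vector_space_axioms L_subspace sum fin this]
  have "?f (k, 0, int N) \<in> L" by blast
  \<comment> \<open>The leading coefficient is a sign, hence invertible over the integers:
    multiplying by it once more removes it.\<close>
  then have "sW3 (- ((-1) powi k)) (I w1 n (YW2 v j w2)) \<in> L"
    by (simp add: delta_coeff_def k_def m_def n'_def)
  then have "sW3 (- ((-1) powi k)) (sW3 (- ((-1) powi k)) (I w1 n (YW2 v j w2))) \<in> L"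
    by (rule int_subspace_scale [OF W3.W.vector_space_axioms L_subspace, rotated])
      (intro Ints_minus minus_one_power_int_in_Ints)
  moreover have "- ((-1) powi k) * - ((-1) powi k) = (1 :: complex)"
    by (simp add: power_int_minus_left)
  ultimately show ?thesis
    by (simp only: W3.W.scale_scale W3.W.scale_one)
qed

lemma integral_right_mode:
  assumes "v \<in> VZ" and "\<And>n. I w1 n w2 \<in> L"
  shows "I w1 n (YW2 v j w2) \<in> L"
proof -
  obtain N where N: "\<And>i. i \<ge> N \<Longrightarrow> YW2 v i w2 = 0"
    using W2.truncation by blast
  show ?thesis
  \<comment> \<open>The descending induction starts where truncation gives
    \<open>v_i w2 = 0\<close>. The index \<open>n\<close> is generalized because the recursion
    shifts it.\<close>
  proof (induction "nat (N - j)" arbitrary: j n rule: less_induct)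
    case less
    show ?case
    proof (cases "j \<ge> N")
      case True
      then show ?thesis by (simp add: N Z3.subspace_0 [OF L_subspace])
    next
      case False
      show ?thesis
      proof (rule weak_commutativity_integral [OF assms])
        fix i n
        assume "i > j"
        with False show "I w1 n (YW2 v i w2) \<in> L" by (intro less) simp
      qed
    qed
  qed
qed

text \<open>The coefficient of \<open>x_1^(-1)\<close> in the Jacobi identity is the iterate
  formula: its right-hand side is the single vector \<open>I (YW1 v j w1) n w2\<close>, its
  left-hand side an integer combination of modes \<open>v_i I(w1) w2\<close> and
  \<open>I(w1) v_i w2\<close>.\<close>

lemma integral_left_mode:
  assumes v: "v \<in> VZ" and w2: "\<And>n. I w1 n w2 \<in> L" and v2: "\<And>i n. I w1 n (YW2 v i w2) \<in> L"
  shows "I (YW1 v j w1) n w2 \<in> L"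
proof -
  define k :: int where "k = - j - 1"
  define n' :: complex where "n' = - n - 1"
  let ?f = "\<lambda>(p, q, r). sW3 (delta_coeff r q p)
    (if - 1 - q = 0 then I (YW1 v (- (k - p) - 1) w1) (- (n' - of_int r) - 1) w2 else 0)"
  \<comment> \<open>With \<open>q = -1\<close> only \<open>r = -p\<close> counts, and \<open>p - 1\<close> choose \<open>p\<close> vanishes for \<open>p > 0\<close>.\<close>
  have supp: "(p, q, r) = (0, - 1, 0)" if nz: "?f (p, q, r) \<noteq> 0" for p q r
  proof -
    have q: "q = - 1" and d: "delta_coeff r q p \<noteq> 0"
      using nz by (auto split: if_splits)
    then have p: "p \<ge> 0" "r = - p"
      by (auto simp: delta_coeff_def split: if_splits)
    with d q have g: "(of_int (p - 1) :: complex) gchoose nat p \<noteq> 0"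
      by (simp add: delta_coeff_def)
    have "p = 0"
      using p(1) g gbinomial_of_int_eq_0 [of "p - 1" "nat p"] by force
    with p q show ?thesis by simp
  qed
  have "Sum_any ?f = sum ?f {(0, - 1, 0)}"
    using supp by (intro Sum_any.expand_superset) (auto simp del: split_conv)
  also have "\<dots> = I (YW1 v j w1) n w2"
    by (simp add: delta_coeff_def k_def n'_def)
  finally have iterate: "series_mult sW3 (\<lambda>p q r. delta_coeff r q p)
      (\<lambda>p q r. if q = 0 then I (YW1 v (- p - 1) w1) (- r - 1) w2 else 0) k (- 1) n'
      = I (YW1 v j w1) n w2"
    by (simp only: series_mult_def)
  have "series_mult sW3 (\<lambda>p q r. - ((-1) powi p) * delta_coeff p r q)
      (\<lambda>p q r. if p = 0 then I w1 (- r - 1) (YW2 v (- q - 1) w2) else 0) k (- 1) n' \<in> L"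
    by (rule int_subspace_series_mult [OF W3.W.vector_space_axioms L_subspace])
      (auto intro!: Ints_mult Ints_minus minus_one_power_int_in_Ints delta_coeff_in_Ints v2
        Z3.subspace_0 [OF L_subspace])
  from Z3.subspace_diff [OF L_subspace integral_first_series [OF v w2, of k "- 1" n'] this]
  show ?thesis
    using jacobi iterate by (simp only: jacobi_identity_def)
qed

section \<open>From generators to the whole modules\<close>

lemma integral_submodule_right:
  "integral_submodule VZ sW2 YW2 {w2. \<forall>i\<in>A \<times> UNIV. I (fst i) (snd i) w2 \<in> L}"
  unfolding integral_submodule_def
  by (intro conjI int_subspace_linear_vimage [OF W3.W.vector_space_axioms L_subspace] linear_right
      W2.W.vector_space_axioms) (auto intro: integral_right_mode)

text \<open>The iterate formula brings in \<open>v_i w2\<close>, so the second arguments must range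
  over a set closed under \<open>VZ\<close>; on the other side \<open>A\<close> may be any set,
  since \<open>w1\<close> stays fixed there.\<close>

lemma integral_submodule_left:
  assumes "integral_submodule VZ sW2 YW2 M"
  shows "integral_submodule VZ sW1 YW1 {w1. \<forall>i\<in>M \<times> UNIV. I w1 (snd i) (fst i) \<in> L}"
  using assms unfolding integral_submodule_def
  by (intro conjI int_subspace_linear_vimage [OF W3.W.vector_space_axioms L_subspace] linear_left
      W1.W.vector_space_axioms) (auto intro!: integral_left_mode)

text \<open>Minimality is used twice: first for \<open>M2\<close> with \<open>w1\<close> in
  \<open>T1\<close>, then for \<open>M1\<close> with \<open>w2\<close> in the submodule
  \<open>M2\<close>, as \<open>integral_submodule_left\<close> demands.\<close>

lemma integral_if_integral_on_generators:
  assumes g1: "generates VZ sW1 YW1 T1 M1" and g2: "generates VZ sW2 YW2 T2 M2"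
    and T: "\<And>t1 t2 n. t1 \<in> T1 \<Longrightarrow> t2 \<in> T2 \<Longrightarrow> I t1 n t2 \<in> L"
    and "w1 \<in> M1" and "w2 \<in> M2"
  shows "I w1 n w2 \<in> L"
proof -
  have "T2 \<subseteq> {w2. \<forall>i\<in>T1 \<times> UNIV. I (fst i) (snd i) w2 \<in> L}"
    using T by auto
  with g2 integral_submodule_right
  have "M2 \<subseteq> {w2. \<forall>i\<in>T1 \<times> UNIV. I (fst i) (snd i) w2 \<in> L}"
    unfolding generates_def by blast
  then have "T1 \<subseteq> {w1. \<forall>i\<in>M2 \<times> UNIV. I w1 (snd i) (fst i) \<in> L}"
    by auto
  moreover have "integral_submodule VZ sW2 YW2 M2"
    using g2 by (simp add: generates_def)
  ultimately have "M1 \<subseteq> {w1. \<forall>i\<in>M2 \<times> UNIV. I w1 (snd i) (fst i) \<in> L}"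
    using g1 integral_submodule_left unfolding generates_def by blast
  with assms show ?thesis by auto
qed

end

end

theorem theorem3p9:
  fixes sV :: "complex \<Rightarrow> 'v::ab_group_add \<Rightarrow> 'v"
    and Y :: "'v \<Rightarrow> int \<Rightarrow> 'v \<Rightarrow> 'v"
    and vac :: 'v and \<omega> :: 'v and c :: complex
    and sW1 :: "complex \<Rightarrow> 'w1::ab_group_add \<Rightarrow> 'w1" and YW1 :: "'v \<Rightarrow> int \<Rightarrow> 'w1 \<Rightarrow> 'w1"
    and sW2 :: "complex \<Rightarrow> 'w2::ab_group_add \<Rightarrow> 'w2" and YW2 :: "'v \<Rightarrow> int \<Rightarrow> 'w2 \<Rightarrow> 'w2"
    and sW3 :: "complex \<Rightarrow> 'w3::ab_group_add \<Rightarrow> 'w3" and YW3 :: "'v \<Rightarrow> int \<Rightarrow> 'w3 \<Rightarrow> 'w3"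
    and I :: "'w1 \<Rightarrow> complex \<Rightarrow> 'w2 \<Rightarrow> 'w3"
    and VZ :: "'v set" and W1Z :: "'w1 set" and W2Z :: "'w2 set" and W3Z :: "'w3 set"
    and T1 :: "'w1 set" and T2 :: "'w2 set"
  assumes "vertex_operator_algebra sV Y vac \<omega> c"
    and "voa_integral_form sV Y vac \<omega> VZ"
    and "voa_module sV Y vac \<omega> c sW1 YW1"
    and "voa_module sV Y vac \<omega> c sW2 YW2"
    and "voa_module sV Y vac \<omega> c sW3 YW3"
    and "module_integral_form VZ \<omega> sW1 YW1 W1Z"
    and "module_integral_form VZ \<omega> sW2 YW2 W2Z"
    and "module_integral_form VZ \<omega> sW3 YW3 W3Z"
    and "generates VZ sW1 YW1 T1 W1Z"
    and "generates VZ sW2 YW2 T2 W2Z"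
    and "intertwining_operator sV Y vac \<omega> c sW1 YW1 sW2 YW2 sW3 YW3 I"
    and "\<And>t1 t2. t1 \<in> T1 \<Longrightarrow> t2 \<in> T2 \<Longrightarrow> (\<lambda>n. I t1 n t2) \<in> formal_series W3Z"
  shows "integral_intertwining I W1Z W2Z W3Z"
proof -
  interpret intertwining_operator sV Y vac \<omega> c sW1 YW1 sW2 YW2 sW3 YW3 I
    by fact
  have "integral_submodule VZ sW3 YW3 W3Z"
    using assms(8) by (simp add: module_integral_form_def)
  from integral_if_integral_on_generators [OF this assms(9,10)] assms(12) show ?thesis
    by (auto simp: integral_intertwining_def formal_series_def)
qed

end
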